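(* Let $\{G(t)\}_{t\ge 0}$ be a $B$-strongly-connected sequence of directed graphs on $\{1,\dots,n\}$. Let each $f_i:\mathbb{R}^d\to\mathbb{R}$, $i=1,\dots,n$, be $\mu_i$-strongly convex with $\mu_i>0$ and differentiable, with Lipschitz continuous gradient, i.e., for some scalar $M_i>0$, $\|\nabla f_i(\mathbf{x})-\nabla f_i(\mathbf{y})\|\le M_i\|\mathbf{x}-\mathbf{y}\|$ for all $\mathbf{x},\mathbf{y}\in\mathbb{R}^d$. Consider the stochastic gradient-push iterates $\mathbf{x}_i(t),\mathbf{w}_i(t),\mathbf{z}_i(t),y_i(t)$ (defined in the context) with positive stepsizes satisfying $\lim_{t\to\infty}\alpha(t)=0$. Then there exists a (deterministic) scalar $D$ such that, with probability $1$, $\sup_t\|\mathbf{z}_i(t)\|\le D$ for all $i=1,\dots,n$.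
   Context: Graphs. $G(t)$, $t=0,1,2,\dots$, are directed graphs with vertex set $\{1,\dots,n\}$ and edge set $E(t)$. $N_i^{\rm in}(t)$ and $N_i^{\rm out}(t)$ are the in- and out-neighborhoods of node $i$ at time $t$; by convention $i$ belongs to both. $d_i(t)=|N_i^{\rm out}(t)|$ is the out-degree (counting $i$ itself). The sequence is $B$-strongly-connected if $B$ is a positive integer such that for each $k\ge 0$ the graph with edge set $\bigcup_{t=kB}^{(k+1)B-1}E(t)$ is strongly connected. Strong convexity. A convex $f:\mathbb{R}^d\to\mathbb{R}$ is $\mu$-strongly convex ($\mu>0$) if $f(\mathbf{x})-f(\mathbf{y})\ge g(\mathbf{y})'(\mathbf{x}-\mathbf{y})+\frac{\mu}{2}\|\mathbf{x}-\mathbf{y}\|^2$ for all $\mathbf{x},\mathbf{y}\in\mathbb{R}^d$ and any subgradient $g(\mathbf{y})$ of $f$ at $\mathbf{y}$. Noisy gradients. Given a point $\mathbf{u}\in\mathbb{R}^d$, node $i$ can generate $\mathbf{g}_i(\mathbf{u})=\nabla f_i(\mathbf{u})+\mathbf{N}_i(\mathbf{u})$, where $\mathbf{N}_i(\mathbf{u})$ is an independent random vector with $\mathbb{E}[\mathbf{N}_i(\mathbf{u})]=0$. For every $i$ there is a scalar $c_i>0$ such that, every time a noisy gradient is generated, with probability 1 $\|\mathbf{N}_i(\mathbf{u})\|\le c_i$ for all $\mathbf{u}\in\mathbb{R}^d$. Stochastic gradient-push. Each node $i$ maintains $\mathbf{x}_i(t),\mathbf{w}_i(t),\mathbf{z}_i(t)\in\mathbb{R}^d$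 and $y_i(t)\in\mathbb{R}$; the initial points $\mathbf{x}_i(0)$ are deterministic and $y_i(0)=1$. For all $t\ge 0$ and all $i$, $$\mathbf{w}_i(t+1)=\sum_{j\in N_i^{\rm in}(t)}\frac{\mathbf{x}_j(t)}{d_j(t)},\quad y_i(t+1)=\sum_{j\in N_i^{\rm in}(t)}\frac{y_j(t)}{d_j(t)},\quad \mathbf{z}_i(t+1)=\frac{\mathbf{w}_i(t+1)}{y_i(t+1)},\quad \mathbf{x}_i(t+1)=\mathbf{w}_i(t+1)-\alpha(t+1)\mathbf{g}_i(t+1),$$ where $\mathbf{g}_i(t+1)=\mathbf{g}_i(\mathbf{z}_i(t+1))$ and $\alpha(t+1)>0$ is the stepsize. The supremum over $t$ is over $t\ge 1$, where $\mathbf{z}_i(t)$ is defined by the recursion. $\|\cdot\|$ is the Euclidean norm. *)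

theory Defs
  imports "HOL-Probability.Probability" "Graph_Theory.Graph_Theory"
begin

section \<open>Time-varying directed graphs\<close>

text \<open>
  An arc \<open>(j, i)\<close> means that \<open>j\<close> sends to \<open>i\<close>. Every node belongs to its own neighborhoods,
  whether or not the graph has a self-loop there.
\<close>

definition in_nbhd :: "'v pair_pre_digraph \<Rightarrow> 'v \<Rightarrow> 'v set" where
  "in_nbhd G i = insert i {j. (j, i) \<in> parcs G}"

definition out_nbhd :: "'v pair_pre_digraph \<Rightarrow> 'v \<Rightarrow> 'v set" where
  "out_nbhd G i = insert i {j. (i, j) \<in> parcs G}"

definition deg_out :: "'v pair_pre_digraph \<Rightarrow> 'v \<Rightarrow> nat" where
  "deg_out G i = card (out_nbhd G i)"

definition digraph_sequence :: "nat \<Rightarrow> (nat \<Rightarrow> nat pair_pre_digraph) \<Rightarrow> bool" where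
  "digraph_sequence n G \<longleftrightarrow> (\<forall>t. pair_wf_digraph (G t) \<and> pverts (G t) = {1..n})"

definition B_strongly_connected ::
    "nat \<Rightarrow> nat \<Rightarrow> (nat \<Rightarrow> nat pair_pre_digraph) \<Rightarrow> bool" where
  "B_strongly_connected n B G \<longleftrightarrow> B > 0 \<and>
     (\<forall>k. strongly_connected (with_proj
        \<lparr> pverts = {1..n}, parcs = (\<Union>t\<in>{k * B..<(k + 1) * B}. parcs (G t)) \<rparr>))"


section \<open>Strong convexity\<close>

definition is_subgradient :: "('a::real_inner \<Rightarrow> real) \<Rightarrow> 'a \<Rightarrow> 'a \<Rightarrow> bool" where
  "is_subgradient f y g \<longleftrightarrow> (\<forall>x. f x \<ge> f y + g \<bullet> (x - y))"

definition strongly_convex :: "real \<Rightarrow> ('a::real_inner \<Rightarrow> real) \<Rightarrow> bool" where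
  "strongly_convex \<mu> f \<longleftrightarrow> \<mu> > 0 \<and> convex_on UNIV f \<and>
     (\<forall>x y g. is_subgradient f y g \<longrightarrow>
        f x - f y \<ge> g \<bullet> (x - y) + \<mu> / 2 * (norm (x - y))\<^sup>2)"


section \<open>Noisy gradients and stochastic gradient-push\<close>

text \<open>
  \<open>N t i u\<close> is the noise of the gradient that node \<open>i\<close> generates at time \<open>t \<ge> 1\<close> if it
  queries the point \<open>u\<close>. Since the queried points are themselves random, independence is
  that of the random fields \<open>N t i\<close>, \<open>t \<ge> 1\<close>, \<open>1 \<le> i \<le> n\<close>, and the almost sure bound
  holds simultaneously for all \<open>u\<close>. Values of \<open>N t i u\<close> for different \<open>u\<close> may be arbitrarily
  dependent, and the distribution may depend on \<open>t\<close>.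
\<close>

definition gradient_noise ::
    "'w measure \<Rightarrow> nat \<Rightarrow> (nat \<Rightarrow> real) \<Rightarrow>
     (nat \<Rightarrow> nat \<Rightarrow> real ^ 'd \<Rightarrow> 'w \<Rightarrow> real ^ 'd) \<Rightarrow> bool" where
  "gradient_noise P n c N \<longleftrightarrow>
     prob_space.indep_vars P (\<lambda>_. Pi\<^sub>M UNIV (\<lambda>_. borel))
       (\<lambda>(t, i) \<omega> u. N t i u \<omega>) ({1..} \<times> {1..n}) \<and>
     (\<forall>t\<ge>1. \<forall>i\<in>{1..n}. \<forall>u. has_bochner_integral P (N t i u) 0) \<and>
     (\<forall>i\<in>{1..n}. c i > 0) \<and>
     (\<forall>t\<ge>1. \<forall>i\<in>{1..n}. AE \<omega> in P. \<forall>u. norm (N t i u \<omega>) \<le> c i)"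

text \<open>
  The variables \<open>w\<close> and \<open>z\<close> are only determined from time 1 on; their values at time 0 are
  unconstrained.
\<close>

definition stochastic_gradient_push ::
    "'w measure \<Rightarrow> nat \<Rightarrow> (nat \<Rightarrow> nat pair_pre_digraph) \<Rightarrow> (nat \<Rightarrow> real) \<Rightarrow>
     (nat \<Rightarrow> real ^ 'd \<Rightarrow> real ^ 'd) \<Rightarrow>
     (nat \<Rightarrow> nat \<Rightarrow> real ^ 'd \<Rightarrow> 'w \<Rightarrow> real ^ 'd) \<Rightarrow>
     (nat \<Rightarrow> real ^ 'd) \<Rightarrow>
     (nat \<Rightarrow> nat \<Rightarrow> 'w \<Rightarrow> real ^ 'd) \<Rightarrow> (nat \<Rightarrow> nat \<Rightarrow> 'w \<Rightarrow> real ^ 'd) \<Rightarrow>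
     (nat \<Rightarrow> nat \<Rightarrow> 'w \<Rightarrow> real ^ 'd) \<Rightarrow> (nat \<Rightarrow> nat \<Rightarrow> real) \<Rightarrow> bool" where
  "stochastic_gradient_push P n G \<alpha> grad N x0 x w z y \<longleftrightarrow>
     (\<forall>i\<in>{1..n}. y 0 i = 1 \<and> (\<forall>\<omega>\<in>space P. x 0 i \<omega> = x0 i)) \<and>
     (\<forall>t. \<forall>i\<in>{1..n}.
        y (t + 1) i = (\<Sum>j\<in>in_nbhd (G t) i. y t j / real (deg_out (G t) j)) \<and>
        (\<forall>\<omega>\<in>space P.
           w (t + 1) i \<omega> = (\<Sum>j\<in>in_nbhd (G t) i. x t j \<omega> /\<^sub>R real (deg_out (G t) j)) \<and>
           z (t + 1) i \<omega> = w (t + 1) i \<omega> /\<^sub>R y (t + 1) i \<and>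
           x (t + 1) i \<omega> = w (t + 1) i \<omega> -
             \<alpha> (t + 1) *\<^sub>R (grad i (z (t + 1) i \<omega>) + N (t + 1) i (z (t + 1) i \<omega>) \<omega>)))"

end

theory Submission
  imports Defs
begin

text \<open>
  The whole proof is one deterministic invariant. Since
  \<open>w\<^sub>i(t+1)\<close> and \<open>y\<^sub>i(t+1)\<close> are mixtures of the \<open>x\<^sub>j(t)\<close> and \<open>y\<^sub>j(t)\<close> with the same nonnegative
  coefficients, the bounds \<open>\<parallel>x\<^sub>j(t)\<parallel> \<le> U y\<^sub>j(t)\<close> for all \<open>j\<close> imply \<open>\<parallel>w\<^sub>i(t+1)\<parallel> \<le> U y\<^sub>i(t+1)\<close>,
  that is, \<open>\<parallel>z\<^sub>i(t+1)\<parallel> \<le> U\<close>: mixing never leaves the ball of radius \<open>U\<close>. What remains is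
  \<open>x\<^sub>i(t+1) = y\<^sub>i(t+1) (z - \<beta> g)\<close> with \<open>z = z\<^sub>i(t+1)\<close>, \<open>g\<close> the noisy gradient of \<open>f\<^sub>i\<close> at \<open>z\<close> and
  effective stepsize \<open>\<beta> = \<alpha>(t+1) / y\<^sub>i(t+1)\<close>. Strong convexity makes \<open>-g\<close> point inwards outside
  of a fixed ball, with strength at least proportional to \<open>\<parallel>z\<parallel>\<close>, while \<open>\<parallel>g\<parallel>\<close> grows at most
  linearly because the gradient is Lipschitz and the noise bounded. Hence for small \<open>\<beta>\<close> the step
  \<open>z \<mapsto> z - \<beta> g\<close> maps every sufficiently large ball into itself
  (\<open>norm_damped_step_le\<close>), and the bound \<open>U\<close> is inherited by time \<open>t + 1\<close>.

  The effective stepsizes tend to \<open>0\<close> because the weights \<open>y\<^sub>i(t)\<close> stay away from \<open>0\<close>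
  (\<open>weights_bounded_below\<close>). This is what connectivity is for: the total weight is always \<open>n\<close>,
  so some node has weight at least \<open>1\<close>, and within \<open>n\<close> blocks of length \<open>B\<close> a fixed fraction of it
  reaches every node. The finitely many steps before the stepsizes are small enlarge \<open>U\<close> by a
  deterministic amount (\<open>bound_inherited_eventually\<close>). Randomness enters only through the event,
  of probability one, that all noise bounds hold at once.
\<close>

section \<open>Push-sum weights\<close>

lemma nodes_nonempty: "B_strongly_connected n B G \<Longrightarrow> 0 < n"
  by (auto simp: B_strongly_connected_def strongly_connected_def)

locale push_sum_weights =
  fixes n :: nat and G :: "nat \<Rightarrow> nat pair_pre_digraph" and y :: "nat \<Rightarrow> nat \<Rightarrow> real"
  assumes digraphs: "digraph_sequence n G"
    and y_init: "i \<in> {1..n} \<Longrightarrow> y 0 i = 1"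
    and y_step: "i \<in> {1..n} \<Longrightarrow> y (Suc t) i = (\<Sum>j\<in>in_nbhd (G t) i. y t j / real (deg_out (G t) j))"
begin

lemma arc_ends_in_nodes: "(j, i) \<in> parcs (G t) \<Longrightarrow> j \<in> {1..n} \<and> i \<in> {1..n}"
proof -
  assume arc: "(j, i) \<in> parcs (G t)"
  interpret pair_wf_digraph "G t"
    using digraphs by (simp add: digraph_sequence_def)
  show ?thesis
    using in_arcsD1[OF arc] in_arcsD2[OF arc] digraphs by (simp add: digraph_sequence_def)
qed

lemma in_nbhd_nodes: "i \<in> {1..n} \<Longrightarrow> in_nbhd (G t) i \<subseteq> {1..n}"
  using arc_ends_in_nodes by (auto simp: in_nbhd_def)

lemma out_nbhd_nodes: "i \<in> {1..n} \<Longrightarrow> out_nbhd (G t) i \<subseteq> {1..n}"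
  using arc_ends_in_nodes by (auto simp: out_nbhd_def)

lemma finite_in_nbhd: "i \<in> {1..n} \<Longrightarrow> finite (in_nbhd (G t) i)"
  using in_nbhd_nodes finite_subset by blast

lemma finite_out_nbhd: "i \<in> {1..n} \<Longrightarrow> finite (out_nbhd (G t) i)"
  using out_nbhd_nodes finite_subset by blast

lemma deg_out_pos: "i \<in> {1..n} \<Longrightarrow> 0 < deg_out (G t) i"
  using finite_out_nbhd[of i t] by (auto simp: deg_out_def card_gt_0_iff out_nbhd_def)

lemma deg_out_le: "i \<in> {1..n} \<Longrightarrow> deg_out (G t) i \<le> n"
  using card_mono[OF _ out_nbhd_nodes[of i t]] by (simp add: deg_out_def)

lemma y_nonneg: "i \<in> {1..n} \<Longrightarrow> 0 \<le> y t i"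
proof (induction t arbitrary: i)
  case 0
  then show ?case by (simp add: y_init)
next
  case (Suc t)
  then show ?case
    using in_nbhd_nodes[OF Suc.prems, of t] by (auto simp: y_step intro!: sum_nonneg)
qed

text \<open>A node splits its weight into \<open>deg_out\<close> equal shares, one for each out-neighbor including itself.\<close>

lemma mass_conserved: "(\<Sum>i\<in>{1..n}. y t i) = real n"
proof (induction t)
  case 0
  then show ?case by (simp add: y_init)
next
  case (Suc t)
  let ?q = "\<lambda>j. y t j / real (deg_out (G t) j)"
  have "(\<Sum>i\<in>{1..n}. y (Suc t) i) = (\<Sum>i\<in>{1..n}. \<Sum>j | j \<in> {1..n} \<and> i \<in> out_nbhd (G t) j. ?q j)"
  proof (rule sum.cong[OF refl])
    fix i assume i: "i \<in> {1..n}"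
    then have "in_nbhd (G t) i = {j. j \<in> {1..n} \<and> i \<in> out_nbhd (G t) j}"
      using in_nbhd_nodes[OF i, of t] by (auto simp: in_nbhd_def out_nbhd_def)
    then show "y (Suc t) i = (\<Sum>j | j \<in> {1..n} \<and> i \<in> out_nbhd (G t) j. ?q j)"
      unfolding y_step[OF i] by (rule sum.cong) simp_all
  qed
  also have "\<dots> = (\<Sum>j\<in>{1..n}. \<Sum>i | i \<in> {1..n} \<and> i \<in> out_nbhd (G t) j. ?q j)"
    by (rule sum.swap_restrict) auto
  also have "\<dots> = (\<Sum>j\<in>{1..n}. y t j)"
  proof (rule sum.cong[OF refl])
    fix j assume j: "j \<in> {1..n}"
    then have "{i. i \<in> {1..n} \<and> i \<in> out_nbhd (G t) j} = out_nbhd (G t) j"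
      using out_nbhd_nodes[OF j, of t] by auto
    then show "(\<Sum>i | i \<in> {1..n} \<and> i \<in> out_nbhd (G t) j. ?q j) = y t j"
      using deg_out_pos[OF j, of t] by (simp add: deg_out_def)
  qed
  finally show ?case using Suc.IH by simp
qed

lemma y_step_ge:
  assumes "i \<in> {1..n}" "j \<in> in_nbhd (G t) i"
  shows "y t j / real n \<le> y (Suc t) i"
proof -
  have j: "j \<in> {1..n}" using assms in_nbhd_nodes by blast
  have "y t j / real n \<le> y t j / real (deg_out (G t) j)"
    using deg_out_pos[OF j, of t] deg_out_le[OF j, of t] y_nonneg[OF j]
    by (intro divide_left_mono) auto
  also have "\<dots> \<le> (\<Sum>j\<in>in_nbhd (G t) i. y t j / real (deg_out (G t) j))"
    using in_nbhd_nodes[OF assms(1), of t]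
    by (intro member_le_sum[where f = "\<lambda>j. y t j / real (deg_out (G t) j)"] assms(2)
          finite_in_nbhd[OF assms(1)]) (auto intro!: divide_nonneg_nonneg y_nonneg)
  finally show ?thesis by (simp only: y_step[OF assms(1)])
qed

text \<open>
  One step passes on at least the fraction \<open>1 / n\<close> of a weight, so after \<open>\<tau>\<close> steps these nodes
  include all that can be reached, from time \<open>s\<close> on, from a node of weight at least \<open>1\<close>.
\<close>

definition heavy :: "nat \<Rightarrow> nat \<Rightarrow> nat set" where
  "heavy s \<tau> = {i \<in> {1..n}. (1 / real n) ^ \<tau> \<le> y (s + \<tau>) i}"

lemma heavy_subset: "heavy s \<tau> \<subseteq> {1..n}"
  by (auto simp: heavy_def)

lemma heavy_step:
  assumes "j \<in> heavy s \<tau>" "i \<in> {1..n}" "j \<in> in_nbhd (G (s + \<tau>)) i"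
  shows "i \<in> heavy s (Suc \<tau>)"
proof -
  have "(1 / real n) ^ Suc \<tau> \<le> y (s + \<tau>) j / real n"
    using assms(1) by (simp add: heavy_def divide_right_mono)
  also have "\<dots> \<le> y (Suc (s + \<tau>)) i"
    by (rule y_step_ge[OF assms(2,3)])
  finally show ?thesis using assms(2) by (simp add: heavy_def)
qed

lemma heavy_mono: "\<tau> \<le> \<tau>' \<Longrightarrow> heavy s \<tau> \<subseteq> heavy s \<tau>'"
proof (rule lift_Suc_mono_le[where f = "heavy s"])
  show "heavy s m \<subseteq> heavy s (Suc m)" for m
    using heavy_step[of _ s m] heavy_subset[of s m] by (auto simp: in_nbhd_def)
qed

lemma block_arc_leaving:
  assumes conn: "B_strongly_connected n B G" and "S \<subset> {1..n}" "S \<noteq> {}"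
  obtains t j i where "k * B \<le> t" "t < (k + 1) * B" "(j, i) \<in> parcs (G t)" "j \<in> S" "i \<notin> S"
proof (rule ccontr)
  assume "\<not> thesis"
  with that have closed: "i \<in> S"
    if "k * B \<le> t" "t < (k + 1) * B" "(j, i) \<in> parcs (G t)" "j \<in> S" for t j i
    using that by blast
  let ?E = "\<Union>t\<in>{k * B..<(k + 1) * B}. parcs (G t)"
  let ?H = "with_proj \<lparr>pverts = {1..n}, parcs = ?E\<rparr>"
  obtain u v where uv: "u \<in> S" "v \<in> {1..n}" "v \<notin> S" using assms(2,3) by blast
  have "strongly_connected ?H"
    using conn by (simp add: B_strongly_connected_def)
  then have "u \<rightarrow>\<^sup>*\<^bsub>?H\<^esub> v"
    using uv assms(2) by (auto simp: strongly_connected_def)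
  then have "(u, v) \<in> rtrancl_on {1..n} ?E"
    by (simp add: reachable_def arcs_ends_def arc_to_ends_def)
  then have "v \<in> S"
    by (induction rule: rtrancl_on_induct) (use uv(1) closed in auto)
  with uv show False by simp
qed

text \<open>
  Every block enlarges the set of heavy nodes until it is everything, because some arc of the
  block leaves the nodes that are heavy at its beginning, and nodes that are heavy stay so.
\<close>

lemma card_heavy_blocks:
  assumes conn: "B_strongly_connected n B G" and start: "heavy (k * B) 0 \<noteq> {}"
  shows "min n (Suc m) \<le> card (heavy (k * B) (m * B))"
proof (induction m)
  case 0
  have "finite (heavy (k * B) 0)" using heavy_subset finite_subset by blast
  then show ?case using start by (simp add: Suc_le_eq card_gt_0_iff min.coboundedI2)
next
  case (Suc m)
  let ?s = "k * B"
  have fin: "finite (heavy ?s \<tau>)" for \<tau> using heavy_subset finite_subset by blast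
  have sub: "heavy ?s (m * B) \<subseteq> heavy ?s (Suc m * B)" by (rule heavy_mono) simp
  show ?case
  proof (cases "heavy ?s (m * B) = {1..n}")
    case True
    then have "heavy ?s (Suc m * B) = {1..n}" using sub heavy_subset by blast
    then show ?thesis by simp
  next
    case False
    then have "heavy ?s (m * B) \<subset> {1..n}" using heavy_subset by blast
    moreover have "heavy ?s (m * B) \<noteq> {}" using start heavy_mono[of 0 "m * B" ?s] by auto
    ultimately obtain t j i where t: "(k + m) * B \<le> t" "t < (k + m + 1) * B"
      and ji: "(j, i) \<in> parcs (G t)" "j \<in> heavy ?s (m * B)" "i \<notin> heavy ?s (m * B)"
      using block_arc_leaving[OF conn, where k = "k + m"] by metis
    define \<tau> where "\<tau> = t - ?s"
    have \<tau>: "t = ?s + \<tau>" "m * B \<le> \<tau>" "Suc \<tau> \<le> Suc m * B"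
      using t by (auto simp: \<tau>_def algebra_simps)
    have "j \<in> heavy ?s \<tau>" using ji(2) heavy_mono[OF \<tau>(2)] by blast
    moreover have "i \<in> {1..n}" using arc_ends_in_nodes[OF ji(1)] by simp
    moreover have "j \<in> in_nbhd (G (?s + \<tau>)) i" using ji(1) \<tau>(1) by (simp add: in_nbhd_def)
    ultimately have "i \<in> heavy ?s (Suc \<tau>)" by (rule heavy_step)
    then have "i \<in> heavy ?s (Suc m * B)" using heavy_mono[OF \<tau>(3)] by blast
    then have "card (heavy ?s (m * B)) < card (heavy ?s (Suc m * B))"
      using sub ji(3) by (intro psubset_card_mono fin) blast
    then show ?thesis using Suc.IH by linarith
  qed
qed

text \<open>
  Go back from \<open>t\<close> by between \<open>n\<close> and \<open>n + 1\<close> blocks to a time \<open>k * B\<close> (or to time \<open>0\<close>): some node has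
  weight at least \<open>1\<close> there, by conservation of the total, and every node is heavy by time \<open>t\<close>.
\<close>

lemma weights_bounded_below:
  assumes conn: "B_strongly_connected n B G"
  obtains \<delta> where "0 < \<delta>" "\<And>t i. i \<in> {1..n} \<Longrightarrow> \<delta> \<le> y t i"
proof -
  have n: "0 < n" using conn by (rule nodes_nonempty)
  have B: "0 < B" using conn by (simp add: B_strongly_connected_def)
  let ?\<delta> = "(1 / real n) ^ ((n + 1) * B)"
  have "?\<delta> \<le> y t i" if i: "i \<in> {1..n}" for t i
  proof -
    have heavyD: "?\<delta> \<le> y (s + \<tau>) i" if "i \<in> heavy s \<tau>" "\<tau> \<le> (n + 1) * B" for s \<tau>
    proof -
      have "?\<delta> \<le> (1 / real n) ^ \<tau>" using that(2) n by (intro power_decreasing) auto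
      then show ?thesis using that(1) by (simp add: heavy_def)
    qed
    show ?thesis
    proof (cases "n \<le> t div B")
      case True
      define k where "k = t div B - n"
      define r where "r = t mod B"
      have "t = (t div B) * B + r" by (simp add: r_def)
      also have "t div B = k + n" using True by (simp add: k_def)
      finally have t: "t = k * B + (n * B + r)" by (simp add: algebra_simps)
      have r: "r < B" using B by (simp add: r_def)
      have "heavy (k * B) 0 \<noteq> {}"
      proof
        assume "heavy (k * B) 0 = {}"
        then have "y (k * B) j < 1" if "j \<in> {1..n}" for j
        proof -
          have "j \<notin> heavy (k * B) 0" using \<open>heavy (k * B) 0 = {}\<close> by simp
          then show ?thesis using that by (simp add: heavy_def)
        qed
        then have "(\<Sum>j\<in>{1..n}. y (k * B) j) < (\<Sum>j\<in>{1..n}. 1)"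
          using n by (intro sum_strict_mono) auto
        then show False using mass_conserved by simp
      qed
      then have "n \<le> card (heavy (k * B) (n * B))"
        using card_heavy_blocks[OF conn, of k n] by simp
      then have "heavy (k * B) (n * B) = {1..n}"
        by (intro card_seteq heavy_subset) auto
      then have "i \<in> heavy (k * B) (n * B + r)"
        using heavy_mono[of "n * B" "n * B + r" "k * B"] i by auto
      then show ?thesis using heavyD[of "k * B" "n * B + r"] r t by simp
    next
      case False
      then have "t < n * B" using B by (simp add: not_le div_less_iff_less_mult)
      moreover have "i \<in> heavy 0 t"
        using heavy_mono[of 0 t 0] i y_init[OF i] by (auto simp: heavy_def)
      ultimately show ?thesis using heavyD[of 0 t] by simp
    qed
  qed
  then show ?thesis using that[of ?\<delta>] n by simp
qed

text \<open>
  Mixing with the same coefficients as the weights is, after division by the weights, an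
  averaging, and so preserves bounds on the ratios.
\<close>

lemma norm_mixture_le:
  fixes x :: "nat \<Rightarrow> 'b::real_normed_vector"
  assumes i: "i \<in> {1..n}" and x: "\<And>j. j \<in> {1..n} \<Longrightarrow> norm (x j) \<le> U * y t j"
  shows "norm (\<Sum>j\<in>in_nbhd (G t) i. x j /\<^sub>R real (deg_out (G t) j)) \<le> U * y (Suc t) i"
proof -
  have "norm (\<Sum>j\<in>in_nbhd (G t) i. x j /\<^sub>R real (deg_out (G t) j))
      \<le> (\<Sum>j\<in>in_nbhd (G t) i. U * (y t j / real (deg_out (G t) j)))"
  proof (rule sum_norm_le)
    fix j assume "j \<in> in_nbhd (G t) i"
    then have "j \<in> {1..n}" using in_nbhd_nodes[OF i] by blast
    from x[OF this] show "norm (x j /\<^sub>R real (deg_out (G t) j)) \<le> U * (y t j / real (deg_out (G t) j))"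
      using mult_left_mono[of "norm (x j)" "U * y t j" "inverse (real (deg_out (G t) j))"]
      by (simp add: divide_inverse mult_ac)
  qed
  also have "\<dots> = U * y (Suc t) i" by (simp only: y_step[OF i] sum_distrib_left)
  finally show ?thesis .
qed

end

section \<open>Gradients of strongly convex functions\<close>

text \<open>Restricting to the line through \<open>u\<close> and \<open>v\<close> reduces this to the one-dimensional tangent inequality.\<close>

lemma is_subgradient_GDERIV:
  fixes f :: "'a::real_inner \<Rightarrow> real"
  assumes conv: "convex_on UNIV f" and deriv: "GDERIV f u :> g"
  shows "is_subgradient f u g"
  unfolding is_subgradient_def
proof
  fix v
  define \<phi> where "\<phi> = (\<lambda>s. f (u + s *\<^sub>R (v - u)))"
  have "convex_on UNIV \<phi>"
  proof (rule convex_onI)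
    fix s a b :: real assume s: "0 < s" "s < 1"
    have "u + ((1 - s) *\<^sub>R a + s *\<^sub>R b) *\<^sub>R (v - u)
        = (1 - s) *\<^sub>R (u + a *\<^sub>R (v - u)) + s *\<^sub>R (u + b *\<^sub>R (v - u))"
      by (simp add: algebra_simps)
    then show "\<phi> ((1 - s) *\<^sub>R a + s *\<^sub>R b) \<le> (1 - s) * \<phi> a + s * \<phi> b"
      using convex_onD[OF conv, of s] s by (simp add: \<phi>_def)
  qed simp
  moreover have "(\<phi> has_field_derivative g \<bullet> (v - u)) (at 0)"
  proof -
    have "(f has_derivative (\<lambda>h. g \<bullet> h)) (at (u + 0 *\<^sub>R (v - u)))"
      using deriv by (simp add: gderiv_def inner_commute)
    moreover have "((\<lambda>s. u + s *\<^sub>R (v - u)) has_derivative (\<lambda>s. s *\<^sub>R (v - u))) (at 0)"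
      by (auto intro!: derivative_eq_intros)
    ultimately have "(\<phi> has_derivative (\<lambda>s. g \<bullet> (s *\<^sub>R (v - u)))) (at 0)"
      unfolding \<phi>_def by (rule has_derivative_compose[rotated])
    then show ?thesis by (simp add: has_field_derivative_def mult_commute_abs)
  qed
  ultimately have "\<phi> 1 - \<phi> 0 \<ge> g \<bullet> (v - u) * (1 - 0)"
    by (intro convex_on_imp_above_tangent[where A = UNIV]) auto
  then show "f u + g \<bullet> (v - u) \<le> f v" by (simp add: \<phi>_def)
qed

text \<open>Add the strong convexity inequalities at \<open>u\<close> and at \<open>v\<close>: the function values cancel.\<close>

lemma strongly_convex_gradient_monotone:
  fixes f :: "'a::real_inner \<Rightarrow> real"
  assumes sc: "strongly_convex \<mu> f" and deriv: "\<And>u. GDERIV f u :> grad u"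
  shows "\<mu> * (norm (u - v))\<^sup>2 \<le> (grad u - grad v) \<bullet> (u - v)"
proof -
  have lower: "grad b \<bullet> (a - b) + \<mu> / 2 * (norm (a - b))\<^sup>2 \<le> f a - f b" for a b
    using sc is_subgradient_GDERIV[OF _ deriv] by (simp add: strongly_convex_def)
  have "(grad u - grad v) \<bullet> (u - v) = - (grad u \<bullet> (v - u)) - grad v \<bullet> (u - v)"
    by (simp add: algebra_simps inner_diff_left inner_diff_right)
  then show ?thesis using lower[of u v] lower[of v u] by (simp add: norm_minus_commute)
qed

text \<open>
  Outside of radius \<open>R = max 1 (2 * C / \<mu>)\<close> the linear error \<open>C * norm z\<close> is at most half of
  the quadratic term, and the decrease of \<open>(norm z)\<^sup>2\<close> to first order in \<open>\<beta>\<close> beats the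
  second-order term. Inside, one step reaches at most radius \<open>R * (1 + L + C)\<close>.
\<close>

lemma norm_damped_step_le:
  fixes z g :: "'a::real_inner"
  assumes \<mu>: "0 < \<mu>" and L: "0 \<le> L" and C: "0 \<le> C"
    and inward: "\<mu> * (norm z)\<^sup>2 - C * norm z \<le> g \<bullet> z"
    and growth: "norm g \<le> L * norm z + C"
    and \<beta>: "0 \<le> \<beta>" "\<beta> \<le> 1" "\<beta> * (L + C)\<^sup>2 \<le> \<mu>"
  shows "norm (z - \<beta> *\<^sub>R g) \<le> max (norm z) (max 1 (2 * C / \<mu>) * (1 + L + C))"
proof (cases "max 1 (2 * C / \<mu>) \<le> norm z")
  case True
  let ?r = "norm z"
  have r: "1 \<le> ?r" "2 * C \<le> \<mu> * ?r" using True \<mu> by (simp_all add: field_simps)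
  have "2 * C * ?r \<le> \<mu> * ?r * ?r" using r by (intro mult_right_mono) auto
  then have inner: "\<mu> * ?r\<^sup>2 \<le> 2 * (g \<bullet> z)"
    using inward by (simp add: power2_eq_square)
  have "norm g \<le> (L + C) * ?r"
    using growth mult_left_mono[OF r(1) C] by (simp add: distrib_right)
  then have "(norm g)\<^sup>2 \<le> ((L + C) * ?r)\<^sup>2" by (rule power_mono) simp
  then have "\<beta> * (norm g)\<^sup>2 \<le> \<beta> * (L + C)\<^sup>2 * ?r\<^sup>2"
    using \<beta>(1) mult_left_mono[of "(norm g)\<^sup>2" _ \<beta>] by (simp add: power_mult_distrib mult.assoc)
  also have "\<dots> \<le> \<mu> * ?r\<^sup>2" using \<beta>(3) by (rule mult_right_mono) simp
  finally have "\<beta> * (norm g)\<^sup>2 \<le> 2 * (g \<bullet> z)" using inner by linarith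
  then have "\<beta> * (\<beta> * (norm g)\<^sup>2) \<le> \<beta> * (2 * (g \<bullet> z))" using \<beta>(1) by (rule mult_left_mono)
  moreover have "(norm (z - \<beta> *\<^sub>R g))\<^sup>2 = ?r\<^sup>2 - \<beta> * (2 * (g \<bullet> z)) + \<beta> * (\<beta> * (norm g)\<^sup>2)"
    unfolding power2_norm_eq_inner
    by (simp add: inner_diff_left inner_diff_right inner_commute algebra_simps)
  ultimately have "(norm (z - \<beta> *\<^sub>R g))\<^sup>2 \<le> ?r\<^sup>2" by linarith
  then have "norm (z - \<beta> *\<^sub>R g) \<le> ?r" by (rule power2_le_imp_le) simp
  then show ?thesis by simp
next
  case False
  let ?R = "max 1 (2 * C / \<mu>)"
  have "norm (z - \<beta> *\<^sub>R g) \<le> norm z + \<beta> * norm g"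
    using norm_triangle_ineq4[of z "\<beta> *\<^sub>R g"] \<beta>(1) by simp
  also have "\<beta> * norm g \<le> norm g" using \<beta> by (simp add: mult_left_le_one_le)
  also have "norm g \<le> L * ?R + C * ?R"
    using growth mult_left_mono[of "norm z" ?R L] mult_left_mono[of 1 ?R C] L C False by simp
  finally have "norm (z - \<beta> *\<^sub>R g) \<le> ?R + (L * ?R + C * ?R)"
    using False by linarith
  also have "\<dots> = ?R * (1 + L + C)" by (simp only: distrib_left mult_1_right mult.commute[of ?R] add.assoc)
  finally show ?thesis by simp
qed

section \<open>Uniform boundedness of the iterates\<close>

text \<open>
  Before time \<open>T\<close> the bound may grow at each step, but only finitely often; from then on, once it
  is at least \<open>R\<close>, it stays.
\<close>

lemma bound_inherited_eventually:
  fixes Q :: "nat \<Rightarrow> real \<Rightarrow> bool"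
  assumes mono: "\<And>t U V. Q t U \<Longrightarrow> U \<le> V \<Longrightarrow> Q t V"
    and init: "Q 0 U0"
    and crude: "\<And>t U. Q t U \<Longrightarrow> \<exists>V. Q (Suc t) V"
    and late: "\<And>t U. T \<le> t \<Longrightarrow> R \<le> U \<Longrightarrow> Q t U \<Longrightarrow> Q (Suc t) U"
  shows "\<exists>U. \<forall>t. Q t U"
proof -
  have "\<exists>U. \<forall>t\<le>m. Q t U" for m
  proof (induction m)
    case 0
    then show ?case using init by auto
  next
    case (Suc m)
    then obtain U where U: "\<And>t. t \<le> m \<Longrightarrow> Q t U" by blast
    then obtain V where V: "Q (Suc m) V" using crude by blast
    have "Q t (max U V)" if "t \<le> Suc m" for t
      using that U V mono by (metis le_Suc_eq max.cobounded1 max.cobounded2)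
    then show ?case by blast
  qed
  then obtain U where U: "\<And>t. t \<le> T \<Longrightarrow> Q t U" by blast
  have early: "Q t (max U R)" if "t \<le> T" for t using U[OF that] mono by simp
  have "Q t (max U R)" for t
  proof (induction t)
    case 0
    then show ?case using early by simp
  next
    case (Suc t)
    then show ?case using early late by (metis max.cobounded2 not_less_eq_eq)
  qed
  then show ?thesis by blast
qed


theorem theorem2:
  fixes n B :: nat
    and G :: "nat \<Rightarrow> nat pair_pre_digraph"
    and f :: "nat \<Rightarrow> real ^ 'd \<Rightarrow> real"
    and grad :: "nat \<Rightarrow> real ^ 'd \<Rightarrow> real ^ 'd"
    and \<mu> L c \<alpha> :: "nat \<Rightarrow> real"
    and P :: "'w measure"
    and N :: "nat \<Rightarrow> nat \<Rightarrow> real ^ 'd \<Rightarrow> 'w \<Rightarrow> real ^ 'd"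
    and x0 :: "nat \<Rightarrow> real ^ 'd"
    and x w z :: "nat \<Rightarrow> nat \<Rightarrow> 'w \<Rightarrow> real ^ 'd"
    and y :: "nat \<Rightarrow> nat \<Rightarrow> real"
  assumes "digraph_sequence n G"
    and "B_strongly_connected n B G"
    and "\<And>i. i \<in> {1..n} \<Longrightarrow> \<mu> i > 0"
    and "\<And>i. i \<in> {1..n} \<Longrightarrow> strongly_convex (\<mu> i) (f i)"
    and "\<And>i u. i \<in> {1..n} \<Longrightarrow> GDERIV (f i) u :> grad i u"
    and "\<And>i. i \<in> {1..n} \<Longrightarrow> L i > 0"
    and "\<And>i. i \<in> {1..n} \<Longrightarrow> (L i)-lipschitz_on UNIV (grad i)"
    and "prob_space P"
    and "gradient_noise P n c N"
    and "\<And>t. t \<ge> 1 \<Longrightarrow> \<alpha> t > 0"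
    and "\<alpha> \<longlonglongrightarrow> 0"
    and "stochastic_gradient_push P n G \<alpha> grad N x0 x w z y"
  shows "\<exists>D::real. AE \<omega> in P. \<forall>i\<in>{1..n}. (SUP t\<in>{1..}. ereal (norm (z t i \<omega>))) \<le> ereal D"
proof -
  note sgp = assms(12)[unfolded stochastic_gradient_push_def]
  interpret prob_space P by fact
  interpret push_sum_weights n G y
    using assms(1) sgp by unfold_locales auto
  have w_step: "w (Suc t) i \<omega> = (\<Sum>j\<in>in_nbhd (G t) i. x t j \<omega> /\<^sub>R real (deg_out (G t) j))"
    and z_step: "z (Suc t) i \<omega> = w (Suc t) i \<omega> /\<^sub>R y (Suc t) i"
    and x_step: "x (Suc t) i \<omega> = w (Suc t) i \<omega> -
      \<alpha> (Suc t) *\<^sub>R (grad i (z (Suc t) i \<omega>) + N (Suc t) i (z (Suc t) i \<omega>) \<omega>)"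
    if "i \<in> {1..n}" "\<omega> \<in> space P" for t i \<omega>
    using sgp that by auto
  have x_init: "x 0 i \<omega> = x0 i" if "i \<in> {1..n}" "\<omega> \<in> space P" for i \<omega>
    using sgp that by blast

  define A where "A = {\<omega> \<in> space P. \<forall>t. \<forall>i\<in>{1..n}. \<forall>u. norm (N (Suc t) i u \<omega>) \<le> c i}"
  have noise_AE: "AE \<omega> in P. \<forall>u. norm (N (Suc t) i u \<omega>) \<le> c i" if "i \<in> {1..n}" for t i
    using assms(9) that by (simp add: gradient_noise_def)
  have "AE \<omega> in P. \<forall>t. \<forall>i\<in>{1..n}. \<forall>u. norm (N (Suc t) i u \<omega>) \<le> c i"
    using noise_AE by (simp add: AE_all_countable AE_finite_all)
  then have AE_A: "AE \<omega> in P. \<omega> \<in> A"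
    using AE_space by eventually_elim (simp add: A_def)

  obtain \<delta> where \<delta>: "0 < \<delta>" "\<And>t i. i \<in> {1..n} \<Longrightarrow> \<delta> \<le> y t i"
    using weights_bounded_below[OF assms(2)] by blast
  have y_pos: "0 < y t i" if "i \<in> {1..n}" for t i
    using \<delta>(1) \<delta>(2)[OF that, of t] by linarith

  define m where "m = Min (\<mu> ` {1..n})"
  define K where "K = (\<Sum>i\<in>{1..n}. L i)"
  define C where "C = (\<Sum>i\<in>{1..n}. norm (grad i 0) + c i)"
  have c_pos: "c i > 0" if "i \<in> {1..n}" for i
    using assms(9) that by (simp add: gradient_noise_def)
  have m: "0 < m" "\<And>i. i \<in> {1..n} \<Longrightarrow> m \<le> \<mu> i"
    using assms(3) nodes_nonempty[OF assms(2)] by (auto simp: m_def Suc_le_eq)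
  have K: "0 \<le> K" "\<And>i. i \<in> {1..n} \<Longrightarrow> L i \<le> K"
    unfolding K_def using less_imp_le[OF assms(6)] by (blast intro: sum_nonneg member_le_sum)+
  have C_term: "0 \<le> norm (grad i 0) + c i" if "i \<in> {1..n}" for i
    using c_pos[OF that] by (simp add: add_nonneg_nonneg)
  have C: "0 \<le> C" "\<And>i. i \<in> {1..n} \<Longrightarrow> norm (grad i 0) + c i \<le> C"
    unfolding C_def using C_term
    by (blast intro: sum_nonneg member_le_sum[of _ _ "\<lambda>i. norm (grad i 0) + c i"])+

  have growth: "norm (grad i u + e) \<le> K * norm u + C"
    and inward: "m * (norm u)\<^sup>2 - C * norm u \<le> (grad i u + e) \<bullet> u"
    if i: "i \<in> {1..n}" and e: "norm e \<le> c i" for i u e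
  proof -
    have e0: "norm (grad i 0 + e) \<le> C"
      using norm_triangle_ineq[of "grad i 0" e] e C(2)[OF i] by linarith
    have split: "grad i u + e = (grad i u - grad i 0) + (grad i 0 + e)" by simp
    have "norm (grad i u - grad i 0) \<le> L i * norm u"
      using lipschitz_onD[OF assms(7)[OF i], of u 0] by (simp add: dist_norm)
    also have "\<dots> \<le> K * norm u" using K(2)[OF i] by (rule mult_right_mono) simp
    finally show "norm (grad i u + e) \<le> K * norm u + C"
      unfolding split using e0 norm_triangle_ineq by (metis add_mono order_trans)
    have "m * (norm u)\<^sup>2 \<le> \<mu> i * (norm u)\<^sup>2" using m(2)[OF i] by (rule mult_right_mono) simp
    also have "\<dots> \<le> (grad i u - grad i 0) \<bullet> u"
      using strongly_convex_gradient_monotone[OF assms(4)[OF i] assms(5)[OF i], of u 0] by simp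
    finally have "m * (norm u)\<^sup>2 \<le> (grad i u - grad i 0) \<bullet> u" .
    moreover have "- (C * norm u) \<le> (grad i 0 + e) \<bullet> u"
      using Cauchy_Schwarz_ineq2[of "grad i 0 + e" u] mult_right_mono[OF e0, of "norm u"]
      by (simp add: abs_le_iff)
    ultimately show "m * (norm u)\<^sup>2 - C * norm u \<le> (grad i u + e) \<bullet> u"
      unfolding split inner_add_left[of "grad i u - grad i 0"] by linarith
  qed

  \<comment> \<open>The invariant. It bounds all sample paths in \<open>A\<close> by the same \<open>U\<close>, so the final bound is deterministic.\<close>
  define Q where "Q = (\<lambda>t U. 0 \<le> U \<and> (\<forall>\<omega>\<in>A. \<forall>i\<in>{1..n}. norm (x t i \<omega>) \<le> U * y t i))"
  have z_le: "norm (z (Suc t) i \<omega>) \<le> U" if "Q t U" "\<omega> \<in> A" "i \<in> {1..n}" for t U \<omega> i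
  proof -
    have "norm (w (Suc t) i \<omega>) \<le> U * y (Suc t) i"
      using that w_step[OF that(3)] norm_mixture_le[OF that(3), of "\<lambda>j. x t j \<omega>" U t]
      by (simp add: Q_def A_def)
    then show ?thesis
      using that z_step[OF that(3)] y_pos[OF that(3), of "Suc t"]
      by (simp add: A_def field_simps)
  qed
  \<comment> \<open>The update, divided by the weight, is a noisy gradient step with stepsize \<open>\<alpha> / y\<close>.\<close>
  have QI: "Q (Suc t) V"
    if V: "0 \<le> V" and step: "\<And>\<omega> i e. \<omega> \<in> A \<Longrightarrow> i \<in> {1..n} \<Longrightarrow> norm e \<le> c i \<Longrightarrow>
      norm (z (Suc t) i \<omega> - (\<alpha> (Suc t) / y (Suc t) i) *\<^sub>R (grad i (z (Suc t) i \<omega>) + e)) \<le> V" for t V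
  proof -
    have "norm (x (Suc t) i \<omega>) \<le> V * y (Suc t) i" if \<omega>: "\<omega> \<in> A" and i: "i \<in> {1..n}" for \<omega> i
    proof -
      let ?e = "N (Suc t) i (z (Suc t) i \<omega>) \<omega>"
      let ?v = "z (Suc t) i \<omega> - (\<alpha> (Suc t) / y (Suc t) i) *\<^sub>R (grad i (z (Suc t) i \<omega>) + ?e)"
      have \<omega>P: "\<omega> \<in> space P" and e: "norm ?e \<le> c i" using \<omega> i by (auto simp: A_def)
      have "w (Suc t) i \<omega> = y (Suc t) i *\<^sub>R z (Suc t) i \<omega>"
        using z_step[OF i \<omega>P] y_pos[OF i, of "Suc t"] by simp
      then have "x (Suc t) i \<omega> = y (Suc t) i *\<^sub>R ?v"
        using x_step[OF i \<omega>P] y_pos[OF i, of "Suc t"] by (simp add: scaleR_diff_right)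
      then have "norm (x (Suc t) i \<omega>) = y (Suc t) i * norm ?v"
        using y_pos[OF i, of "Suc t"] by simp
      also have "\<dots> \<le> y (Suc t) i * V"
        using step[OF \<omega> i e] y_pos[OF i, of "Suc t"] by (intro mult_left_mono) auto
      finally show ?thesis by (simp add: mult.commute)
    qed
    then show ?thesis using V by (simp add: Q_def)
  qed
  have step_nonneg: "0 \<le> \<alpha> (Suc t) / y (Suc t) i"
    and step_le: "\<alpha> (Suc t) / y (Suc t) i \<le> \<alpha> (Suc t) / \<delta>" if "i \<in> {1..n}" for t i
    using assms(10)[of "Suc t"] y_pos[OF that, of "Suc t"] \<delta>(1) \<delta>(2)[OF that, of "Suc t"]
    by (auto intro!: divide_left_mono)

  \<comment> \<open>After time \<open>T\<close> the effective stepsizes are small enough for \<open>norm_damped_step_le\<close>.\<close>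
  define b where "b = min 1 (m / (1 + (K + C)\<^sup>2))"
  have b: "0 < b" "b \<le> 1" "b * (K + C)\<^sup>2 \<le> m"
  proof -
    have pos: "0 < 1 + (K + C)\<^sup>2" by (simp add: add_pos_nonneg)
    then show "0 < b" "b \<le> 1" using m(1) by (simp_all add: b_def)
    have "b * (K + C)\<^sup>2 \<le> b * (1 + (K + C)\<^sup>2)"
      using \<open>0 < b\<close> by (intro mult_left_mono) auto
    also have "\<dots> \<le> m / (1 + (K + C)\<^sup>2) * (1 + (K + C)\<^sup>2)"
      using pos by (intro mult_right_mono) (auto simp: b_def)
    finally show "b * (K + C)\<^sup>2 \<le> m" using pos by simp
  qed
  have "\<forall>\<^sub>F t in sequentially. \<alpha> t < b * \<delta>"
    using assms(11) b(1) \<delta>(1) by (intro order_tendstoD(2)) auto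
  then obtain T where T: "\<And>t. T \<le> t \<Longrightarrow> \<alpha> t < b * \<delta>"
    by (auto simp: eventually_sequentially)

  define R where "R = max 1 (2 * C / m) * (1 + K + C)"
  have "\<exists>U. \<forall>t. Q t U"
  proof (rule bound_inherited_eventually)
    show "Q t V" if "Q t U" "U \<le> V" for t U V
      unfolding Q_def
    proof (intro conjI ballI)
      show "0 \<le> V" using that by (auto simp: Q_def)
      fix \<omega> i assume *: "\<omega> \<in> A" "i \<in> {1..n}"
      have "U * y t i \<le> V * y t i" using that(2) y_nonneg[OF *(2)] by (rule mult_right_mono)
      then show "norm (x t i \<omega>) \<le> V * y t i" using that(1) * by (force simp: Q_def)
    qed
    show "Q 0 (\<Sum>i\<in>{1..n}. norm (x0 i))"
      by (auto simp: Q_def A_def x_init y_init intro!: sum_nonneg member_le_sum[of _ _ "\<lambda>i. norm (x0 i)"])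
    show "\<exists>V. Q (Suc t) V" if Q: "Q t U" for t U
    proof (intro exI QI)
      let ?a = "\<alpha> (Suc t) / \<delta>"
      have a: "0 \<le> ?a" using assms(10)[of "Suc t"] \<delta>(1) by simp
      have U: "0 \<le> U" using Q by (simp add: Q_def)
      show "0 \<le> U + ?a * (K * U + C)" using U K(1) C(1) a by (intro add_nonneg_nonneg mult_nonneg_nonneg)
      fix \<omega> i and e :: "real ^ 'd" assume *: "\<omega> \<in> A" "i \<in> {1..n}" "norm e \<le> c i"
      let ?z = "z (Suc t) i \<omega>" and ?\<beta> = "\<alpha> (Suc t) / y (Suc t) i"
      have z: "norm ?z \<le> U" by (rule z_le[OF Q *(1,2)])
      have "norm (grad i ?z + e) \<le> K * U + C"
        using growth[OF *(2,3), of ?z] mult_left_mono[OF z K(1)] by linarith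
      then have "?\<beta> * norm (grad i ?z + e) \<le> ?a * (K * U + C)"
        using step_le[OF *(2)] a by (intro mult_mono) auto
      moreover have "norm (?z - ?\<beta> *\<^sub>R (grad i ?z + e)) \<le> norm ?z + ?\<beta> * norm (grad i ?z + e)"
        using norm_triangle_ineq4[of ?z "?\<beta> *\<^sub>R (grad i ?z + e)"] step_nonneg[OF *(2), of t]
        by (metis abs_of_nonneg norm_scaleR)
      ultimately show "norm (?z - ?\<beta> *\<^sub>R (grad i ?z + e)) \<le> U + ?a * (K * U + C)"
        using z by linarith
    qed
    show "Q (Suc t) U" if t: "T \<le> t" and U: "R \<le> U" and Q: "Q t U" for t U
    proof (rule QI)
      show "0 \<le> U" using Q by (simp add: Q_def)
      fix \<omega> i and e :: "real ^ 'd" assume *: "\<omega> \<in> A" "i \<in> {1..n}" "norm e \<le> c i"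
      let ?z = "z (Suc t) i \<omega>" and ?\<beta> = "\<alpha> (Suc t) / y (Suc t) i"
      have "\<alpha> (Suc t) / \<delta> \<le> b" using T[of "Suc t"] t \<delta>(1) by (simp add: field_simps)
      then have \<beta>: "?\<beta> \<le> b" using step_le[OF *(2), of t] by linarith
      have "?\<beta> * (K + C)\<^sup>2 \<le> b * (K + C)\<^sup>2" using \<beta> by (rule mult_right_mono) simp
      then have "norm (?z - ?\<beta> *\<^sub>R (grad i ?z + e)) \<le> max (norm ?z) R"
        unfolding R_def using b \<beta> step_nonneg[OF *(2), of t]
        by (intro norm_damped_step_le[OF m(1) K(1) C(1) inward[OF *(2,3)] growth[OF *(2,3)]]) auto
      then show "norm (?z - ?\<beta> *\<^sub>R (grad i ?z + e)) \<le> U"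
        using z_le[OF Q *(1,2)] U by linarith
    qed
  qed
  then obtain U where U: "\<And>t. Q t U" by blast
  have "(SUP t\<in>{1..}. ereal (norm (z t i \<omega>))) \<le> ereal U" if "\<omega> \<in> A" "i \<in> {1..n}" for \<omega> i
  proof (rule SUP_least)
    fix t :: nat assume "t \<in> {1..}"
    then obtain s where "t = Suc s" by (cases t) auto
    then show "ereal (norm (z t i \<omega>)) \<le> ereal U" using z_le[OF U that] by simp
  qed
  then show ?thesis using AE_A by (intro exI[of _ U]) (auto elim!: eventually_mono)
qed

end
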